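(* Let $\mu\in\mathbb{R}$, $\sigma>0$, $\delta=\mu/\sigma$, let $1\le r<n$, $\ell\ge1$ and $r<s_1<s_2<\dots<s_\ell\le n$. Let $X_{1:n}<\dots<X_{n:n}$ be the order statistics of a sample of size $n$ from the density $\frac1\sigma f\left(\frac{x-\mu}{\sigma}\right)$, and let $\boldsymbol X=(X_{1:n},\dots,X_{r:n})^\top$. Let $\hat X_{s_i:n}=(\boldsymbol\Gamma^{-1}\boldsymbol\Delta_{s_i})^\top\boldsymbol X$, $1\le i\le\ell$, be the simultaneous best linear invariant predictors of $X_{s_1:n},\dots,X_{s_\ell:n}$, where $$\boldsymbol\Gamma=\boldsymbol\Sigma+(\boldsymbol\alpha+\delta\boldsymbol 1)(\boldsymbol\alpha+\delta\boldsymbol 1)^\top,\qquad \boldsymbol\Delta_{s}=\boldsymbol\omega_{s}+(\alpha_{s}+\delta)(\boldsymbol\alpha+\delta\boldsymbol 1).$$ Then they possess the complete mean squared predictive error matrix dominance property: for all linear predictors $X^*_{s_i:n}=\boldsymbol a_i^\top\boldsymbol X$, $\boldsymbol a_i\in\mathbb{R}^r$, $1\le i\le\ell$, and every $\boldsymbol k\in\mathbb{R}^\ell$, $$\boldsymbol k^\top \hat{\boldsymbol W}\boldsymbol k\le \boldsymbol k^\top \boldsymbol W^*\boldsymbol k,$$ where $\hat{\boldsymbol W}$ and $\boldsymbol W^*$ are the $\ell\times\ell$ matrices with entries $\hat W_{ij}=E[(\hat X_{s_i:n}-X_{s_i:n})(\hat X_{s_j:n}-X_{s_j:n})]$ and 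$W^*_{ij}=E[(X^*_{s_i:n}-X_{s_i:n})(X^*_{s_j:n}-X_{s_j:n})]$.
   Context: $f$ is a probability density on $\mathbb{R}$, and the sample consists of $n$ i.i.d. random variables with density $\frac1\sigma f\left(\frac{x-\mu}{\sigma}\right)$ (location-scale family). The standardized order statistics are $Z_{i:n}=(X_{i:n}-\mu)/\sigma$, $1\le i\le n$, assumed to have finite second moments. Notation: $\alpha_i=E[Z_{i:n}]$ for $1\le i\le n$; $\boldsymbol\alpha=(\alpha_1,\dots,\alpha_r)^\top$; $\boldsymbol 1=(1,\dots,1)^\top\in\mathbb{R}^r$; $\boldsymbol\Sigma$ is the $r\times r$ covariance matrix of $(Z_{1:n},\dots,Z_{r:n})^\top$, assumed positive definite; $\boldsymbol\omega_s=(\mathrm{Cov}(Z_{1:n},Z_{s:n}),\dots,\mathrm{Cov}(Z_{r:n},Z_{s:n}))^\top\in\mathbb{R}^r$ for $r<s\le n$. *)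

theory Defs
  imports
    "HOL-Probability.Probability"
    "Jordan_Normal_Form.Gauss_Jordan_Elimination"
begin

text \<open>
  Samples are families \<open>X 1, \<dots>, X n\<close> of real random variables on a probability space \<open>M\<close>, and
  order statistics are indexed from 1, as is usual.  Vectors and matrices are those of
  \<open>Jordan_Normal_Form.Matrix\<close>, whose entries are indexed from 0; hence entry \<open>i\<close> of a vector or
  matrix always belongs to index \<open>Suc i\<close> of the family it is built from.
\<close>

definition is_pdf :: "(real \<Rightarrow> real) \<Rightarrow> bool" where
  "is_pdf f \<longleftrightarrow> f \<in> borel_measurable borel \<and> (\<forall>x. 0 \<le> f x) \<and>
     (\<integral>\<^sup>+x. ennreal (f x) \<partial>lborel) = 1"

definition iid_sample ::
    "'w measure \<Rightarrow> nat \<Rightarrow> (nat \<Rightarrow> 'w \<Rightarrow> real) \<Rightarrow> (real \<Rightarrow> real) \<Rightarrow> bool" where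
  "iid_sample M n X g \<longleftrightarrow>
     prob_space.indep_vars M (\<lambda>_. borel) X {1..n} \<and>
     (\<forall>j\<in>{1..n}. distributed M lborel (X j) (\<lambda>x. ennreal (g x)))"

definition order_stat :: "nat \<Rightarrow> (nat \<Rightarrow> 'w \<Rightarrow> real) \<Rightarrow> nat \<Rightarrow> 'w \<Rightarrow> real" where
  "order_stat n X i \<omega> = sort (map (\<lambda>j. X j \<omega>) [1..<Suc n]) ! (i - 1)"

definition std_order_stat ::
    "real \<Rightarrow> real \<Rightarrow> nat \<Rightarrow> (nat \<Rightarrow> 'w \<Rightarrow> real) \<Rightarrow> nat \<Rightarrow> 'w \<Rightarrow> real" where
  "std_order_stat \<mu> \<sigma> n X i \<omega> = (order_stat n X i \<omega> - \<mu>) / \<sigma>"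

definition covariance :: "'w measure \<Rightarrow> ('w \<Rightarrow> real) \<Rightarrow> ('w \<Rightarrow> real) \<Rightarrow> real" where
  "covariance M U V =
     (\<integral>\<omega>. (U \<omega> - (\<integral>\<omega>'. U \<omega>' \<partial>M)) * (V \<omega> - (\<integral>\<omega>'. V \<omega>' \<partial>M)) \<partial>M)"

definition ones_vec :: "nat \<Rightarrow> real vec" where
  "ones_vec r = vec r (\<lambda>_. 1)"

definition outer_prod :: "real vec \<Rightarrow> real vec \<Rightarrow> real mat" where
  "outer_prod u v = mat (dim_vec u) (dim_vec v) (\<lambda>(i, j). vec_index u i * vec_index v j)"

definition pos_def_mat :: "nat \<Rightarrow> real mat \<Rightarrow> bool" where
  "pos_def_mat r A \<longleftrightarrow> A \<in> carrier_mat r r \<and> transpose_mat A = A \<and>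
     (\<forall>v\<in>carrier_vec r. v \<noteq> 0\<^sub>v r \<longrightarrow> 0 < scalar_prod v (A *\<^sub>v v))"

text \<open>
  In the following, \<open>Z\<close> is the family of standardized order statistics; \<open>mean_vec\<close>, \<open>cov_mat\<close>
  and \<open>cross_cov_vec\<close> are \<open>\<alpha>\<close>, \<open>\<Sigma>\<close> and \<open>\<omega>\<^sub>s\<close>.
\<close>

definition mean_vec :: "'w measure \<Rightarrow> (nat \<Rightarrow> 'w \<Rightarrow> real) \<Rightarrow> nat \<Rightarrow> real vec" where
  "mean_vec M Z r = vec r (\<lambda>i. \<integral>\<omega>. Z (Suc i) \<omega> \<partial>M)"

definition cov_mat :: "'w measure \<Rightarrow> (nat \<Rightarrow> 'w \<Rightarrow> real) \<Rightarrow> nat \<Rightarrow> real mat" where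
  "cov_mat M Z r = mat r r (\<lambda>(i, j). covariance M (Z (Suc i)) (Z (Suc j)))"

definition cross_cov_vec :: "'w measure \<Rightarrow> (nat \<Rightarrow> 'w \<Rightarrow> real) \<Rightarrow> nat \<Rightarrow> nat \<Rightarrow> real vec" where
  "cross_cov_vec M Z r s = vec r (\<lambda>i. covariance M (Z (Suc i)) (Z s))"

definition shifted_mean :: "'w measure \<Rightarrow> (nat \<Rightarrow> 'w \<Rightarrow> real) \<Rightarrow> nat \<Rightarrow> real \<Rightarrow> real vec" where
  "shifted_mean M Z r \<delta> = mean_vec M Z r + \<delta> \<cdot>\<^sub>v ones_vec r"

definition Gamma_mat :: "'w measure \<Rightarrow> (nat \<Rightarrow> 'w \<Rightarrow> real) \<Rightarrow> nat \<Rightarrow> real \<Rightarrow> real mat" where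
  "Gamma_mat M Z r \<delta> =
     cov_mat M Z r + outer_prod (shifted_mean M Z r \<delta>) (shifted_mean M Z r \<delta>)"

definition Delta_vec ::
    "'w measure \<Rightarrow> (nat \<Rightarrow> 'w \<Rightarrow> real) \<Rightarrow> nat \<Rightarrow> real \<Rightarrow> nat \<Rightarrow> real vec" where
  "Delta_vec M Z r \<delta> s =
     cross_cov_vec M Z r s + ((\<integral>\<omega>. Z s \<omega> \<partial>M) + \<delta>) \<cdot>\<^sub>v shifted_mean M Z r \<delta>"

text \<open>
  \<open>mat_inverse\<close> returns an option; it is \<open>None\<close> only for singular \<open>\<Gamma>\<close>, which positive
  definiteness of \<open>\<Sigma>\<close> excludes.
\<close>

definition blip_coeff ::
    "'w measure \<Rightarrow> (nat \<Rightarrow> 'w \<Rightarrow> real) \<Rightarrow> nat \<Rightarrow> real \<Rightarrow> nat \<Rightarrow> real vec" where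
  "blip_coeff M Z r \<delta> s = the (mat_inverse (Gamma_mat M Z r \<delta>)) *\<^sub>v Delta_vec M Z r \<delta> s"

text \<open>The linear predictor \<open>a\<^sup>T (Y 1, \<dots>, Y r)\<close>.\<close>

definition linear_predictor ::
    "nat \<Rightarrow> (nat \<Rightarrow> 'w \<Rightarrow> real) \<Rightarrow> real vec \<Rightarrow> 'w \<Rightarrow> real" where
  "linear_predictor r Y a \<omega> = scalar_prod a (vec r (\<lambda>i. Y (Suc i) \<omega>))"

definition mspe_mat ::
    "'w measure \<Rightarrow> nat \<Rightarrow> (nat \<Rightarrow> 'w \<Rightarrow> real) \<Rightarrow> (nat \<Rightarrow> 'w \<Rightarrow> real) \<Rightarrow> real mat" where
  "mspe_mat M l P T = mat l l (\<lambda>(i, j).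
     \<integral>\<omega>. (P (Suc i) \<omega> - T (Suc i) \<omega>) * (P (Suc j) \<omega> - T (Suc j) \<omega>) \<partial>M)"

end

theory Submission
  imports Defs "Jordan_Normal_Form.Determinant"
begin

text \<open>
  Since \<open>X\<^sub>i\<^sub>:\<^sub>n = \<sigma> (Z\<^sub>i\<^sub>:\<^sub>n + \<delta>)\<close>, the second moments of the order statistics are
  \<open>\<sigma>\<^sup>2\<close> times the entries of \<open>\<Gamma>\<close> and \<open>\<Delta>\<^sub>s\<close>, so \<open>\<Gamma> b = \<Delta>\<^sub>s\<close> says that the prediction
  error of \<open>b\<close> is orthogonal in \<open>L\<^sup>2\<close> to \<open>X\<^sub>1\<^sub>:\<^sub>n, \<dots>, X\<^sub>r\<^sub>:\<^sub>n\<close>.  Any other choice of linear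
  predictors changes the \<open>k\<close>-combination of the errors by a linear combination of these, and
  the claim follows from Pythagoras' theorem.
\<close>

subsection \<open>Square-integrable functions\<close>

text \<open>Membership in real \<open>L\<^sup>2\<close>. Squaring forgets the sign, so integrability
  of the square alone would not make \<open>f\<close> measurable.\<close>

definition sq_integrable :: "'w measure \<Rightarrow> ('w \<Rightarrow> real) \<Rightarrow> bool" where
  "sq_integrable M f \<longleftrightarrow> f \<in> borel_measurable M \<and> integrable M (\<lambda>\<omega>. (f \<omega>)\<^sup>2)"

text \<open>The product is dominated by the sum of the squares, by the inequality of arithmetic and
  geometric means. Every mixed second moment below is finite for this reason.\<close>

lemma sq_integrable_imp_integrable_mult:
  assumes "sq_integrable M f" "sq_integrable M g"
  shows "integrable M (\<lambda>\<omega>. f \<omega> * g \<omega>)"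
proof (rule Bochner_Integration.integrable_bound)
  show "integrable M (\<lambda>\<omega>. (f \<omega>)\<^sup>2 + (g \<omega>)\<^sup>2)"
    using assms by (auto simp: sq_integrable_def)
  show "(\<lambda>\<omega>. f \<omega> * g \<omega>) \<in> borel_measurable M"
    using assms by (auto simp: sq_integrable_def)
  have "\<bar>x * y\<bar> \<le> x\<^sup>2 + y\<^sup>2" for x y :: real
  proof -
    have "2 * (\<bar>x\<bar> * \<bar>y\<bar>) \<le> x\<^sup>2 + y\<^sup>2"
      using sum_squares_bound[of "\<bar>x\<bar>" "\<bar>y\<bar>"] by simp
    then show ?thesis
      using mult_nonneg_nonneg[OF abs_ge_zero abs_ge_zero, of x y]
      by (simp only: abs_mult)
  qed
  then show "AE \<omega> in M. norm (f \<omega> * g \<omega>) \<le> norm ((f \<omega>)\<^sup>2 + (g \<omega>)\<^sup>2)"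
    by simp
qed

lemma sq_integrable_cmult: "sq_integrable M f \<Longrightarrow> sq_integrable M (\<lambda>\<omega>. c * f \<omega>)"
  by (auto simp: sq_integrable_def power_mult_distrib)

lemma sq_integrable_add:
  assumes "sq_integrable M f" "sq_integrable M g"
  shows "sq_integrable M (\<lambda>\<omega>. f \<omega> + g \<omega>)"
  using assms sq_integrable_imp_integrable_mult[OF assms]
  by (auto simp: sq_integrable_def power2_sum mult.assoc)

lemma sq_integrable_diff:
  "sq_integrable M f \<Longrightarrow> sq_integrable M g \<Longrightarrow> sq_integrable M (\<lambda>\<omega>. f \<omega> - g \<omega>)"
  using sq_integrable_add[of M f "\<lambda>\<omega>. -1 * g \<omega>"] sq_integrable_cmult[of M g "-1"] by simp

lemma sq_integrable_sum:
  "(\<And>i. i \<in> I \<Longrightarrow> sq_integrable M (f i)) \<Longrightarrow> sq_integrable M (\<lambda>\<omega>. \<Sum>i\<in>I. f i \<omega>)"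
proof (induction I rule: infinite_finite_induct)
  case (insert i I)
  then show ?case by (simp add: sq_integrable_add)
qed (simp_all add: sq_integrable_def)

lemma (in finite_measure) sq_integrable_const: "sq_integrable M (\<lambda>_. c)"
  by (simp add: sq_integrable_def)

lemma (in finite_measure) sq_integrable_imp_integrable:
  "sq_integrable M f \<Longrightarrow> integrable M f"
  using sq_integrable_imp_integrable_mult[OF _ sq_integrable_const[of 1]] by fastforce

text \<open>Links raw and centred moments: with both shifts equal to \<delta> the right-hand side
  has the shape of the entries of \<Gamma> and \<Delta>.\<close>

lemma (in prob_space) integral_mult_shift:
  assumes U: "sq_integrable M U" and V: "sq_integrable M V"
  shows "(\<integral>\<omega>. (U \<omega> + c) * (V \<omega> + d) \<partial>M)
    = covariance M U V + ((\<integral>\<omega>. U \<omega> \<partial>M) + c) * ((\<integral>\<omega>. V \<omega> \<partial>M) + d)"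
proof -
  have expand: "(\<integral>\<omega>. (U \<omega> + x) * (V \<omega> + y) \<partial>M) = (\<integral>\<omega>. U \<omega> * V \<omega> \<partial>M)
      + y * (\<integral>\<omega>. U \<omega> \<partial>M) + x * (\<integral>\<omega>. V \<omega> \<partial>M) + x * y" for x y
  proof -
    have "(\<integral>\<omega>. (U \<omega> + x) * (V \<omega> + y) \<partial>M)
        = (\<integral>\<omega>. U \<omega> * V \<omega> + y * U \<omega> + x * V \<omega> + x * y \<partial>M)"
      by (simp add: algebra_simps)
    also have "\<dots> = (\<integral>\<omega>. U \<omega> * V \<omega> \<partial>M) + y * (\<integral>\<omega>. U \<omega> \<partial>M) + x * (\<integral>\<omega>. V \<omega> \<partial>M) + x * y"
      using sq_integrable_imp_integrable_mult[OF U V] U V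
      by (simp add: sq_integrable_imp_integrable prob_space)
    finally show ?thesis .
  qed
  \<comment> \<open>The second instance of \<open>expand\<close> shifts by the negated means, so its
    left-hand side is the covariance; it eliminates the integral of \<open>U * V\<close> from the
    first.\<close>
  show ?thesis
    using expand[of c d] expand[of "- (\<integral>\<omega>. U \<omega> \<partial>M)" "- (\<integral>\<omega>. V \<omega> \<partial>M)"]
    by (simp add: covariance_def algebra_simps)
qed

subsection \<open>Measurability of order statistics\<close>

text \<open>In a sorted list the elements up to \<open>x\<close> form an initial segment. This
  trades a statement about a position for a count, which does not depend on the order of the
  list.\<close>

lemma sorted_nth_le_iff:
  fixes ys :: "'a::linorder list"
  assumes "sorted ys" "i < length ys"
  shows "ys ! i \<le> x \<longleftrightarrow> i < length (filter (\<lambda>y. y \<le> x) ys)"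
  using assms
proof (induction ys arbitrary: i)
  case (Cons y ys)
  show ?case
  proof (cases "y \<le> x")
    case True
    then show ?thesis using Cons by (cases i) auto
  next
    case False
    then have "filter (\<lambda>y. y \<le> x) ys = []"
      using Cons.prems by (auto simp: filter_empty_conv)
    moreover have "y \<le> (y # ys) ! i"
      using Cons.prems by (cases i) auto
    ultimately show ?thesis using False by auto
  qed
qed simp

lemma length_filter_le_eq_sum:
  "length (filter P xs) = (\<Sum>i<length xs. if P (xs ! i) then 1 else 0)"
  by (simp add: length_filter_conv_card sum.If_cases Int_def)

text \<open>The \<open>i\<close>-th smallest value is at most \<open>x\<close> iff at least
  \<open>i\<close> sample values are, and this count is a finite sum of indicators of measurable
  events.\<close>

lemma order_stat_measurable:
  assumes X: "\<And>j. j \<in> {1..n} \<Longrightarrow> X j \<in> borel_measurable M" and i: "i \<in> {1..n}"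
  shows "order_stat n X i \<in> borel_measurable M"
proof -
  have "order_stat n X i \<omega> \<le> x \<longleftrightarrow> real i \<le> (\<Sum>j<n. if X (Suc j) \<omega> \<le> x then 1 else 0)" for \<omega> x
  proof -
    let ?xs = "map (\<lambda>j. X j \<omega>) [1..<Suc n]"
    have "order_stat n X i \<omega> \<le> x \<longleftrightarrow> i - 1 < length (filter (\<lambda>y. y \<le> x) (sort ?xs))"
      unfolding order_stat_def using i
      by (intro sorted_nth_le_iff) auto
    also have "length (filter (\<lambda>y. y \<le> x) (sort ?xs)) = length (filter (\<lambda>y. y \<le> x) ?xs)"
      by (simp only: filter_sort length_sort)
    also have "\<dots> = (\<Sum>j<n. if X (Suc j) \<omega> \<le> x then 1 else 0)"
      unfolding length_filter_le_eq_sum by (intro sum.cong) (simp_all del: upt_Suc)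
    \<comment> \<open>Here \<open>1 \<le> i\<close> matters, since the subtraction is on naturals.
      The count becomes real-valued so that Borel measurability of sums applies.\<close>
    also have "i - 1 < \<dots> \<longleftrightarrow> real i \<le> real \<dots>"
      using i by (auto simp del: of_nat_sum)
    also have "real (\<Sum>j<n. if X (Suc j) \<omega> \<le> x then 1 else 0)
        = (\<Sum>j<n. if X (Suc j) \<omega> \<le> x then 1 else 0)"
      unfolding of_nat_sum by (intro sum.cong) auto
    finally show ?thesis .
  qed
  moreover have "(\<lambda>\<omega>. \<Sum>j<n. if X (Suc j) \<omega> \<le> x then 1 else (0::real)) \<in> borel_measurable M" for x
  proof (intro borel_measurable_sum)
    fix j assume "j \<in> {..<n}"
    then have [measurable]: "X (Suc j) \<in> borel_measurable M"
      using X by simp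
    show "(\<lambda>\<omega>. if X (Suc j) \<omega> \<le> x then 1 else (0::real)) \<in> borel_measurable M"
      by measurable
  qed
  then have "{\<omega> \<in> space M. real i \<le> (\<Sum>j<n. if X (Suc j) \<omega> \<le> x then 1 else 0)} \<in> sets M" for x
    by measurable
  ultimately show ?thesis
    by (simp add: borel_measurable_iff_le)
qed

subsection \<open>Orthogonality and the error matrix\<close>

text \<open>\<open>scalar_prod\<close> takes its summation range from its second argument, which has
  dimension \<open>r\<close> here.\<close>

lemma linear_predictor_eq_sum:
  "linear_predictor r Y a \<omega> = (\<Sum>j<r. vec_index a j * Y (Suc j) \<omega>)"
  by (simp add: linear_predictor_def scalar_prod_def lessThan_atLeast0)

lemma quadratic_form_eq_sum:
  fixes k :: "'a::comm_semiring_0 vec"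
  assumes "k \<in> carrier_vec l"
  shows "scalar_prod k (mat l l A *\<^sub>v k)
    = (\<Sum>i<l. \<Sum>j<l. vec_index k i * vec_index k j * A (i, j))"
  using assms
  by (simp add: scalar_prod_def lessThan_atLeast0 sum_distrib_left mult_ac)

text \<open>Reduces the matrix inequality to a scalar one: the quadratic form at \<open>k\<close> is
  the mean square of the single error obtained by combining the \<open>l\<close> errors with weights
  \<open>k\<close>.\<close>

lemma mspe_quadratic_form:
  assumes k: "k \<in> carrier_vec l"
    and E: "\<And>i. i \<in> {1..l} \<Longrightarrow> sq_integrable M (\<lambda>\<omega>. P i \<omega> - T i \<omega>)"
  shows "scalar_prod k (mspe_mat M l P T *\<^sub>v k)
    = (\<integral>\<omega>. (\<Sum>i<l. vec_index k i * (P (Suc i) \<omega> - T (Suc i) \<omega>))\<^sup>2 \<partial>M)"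
proof -
  let ?E = "\<lambda>i \<omega>. P (Suc i) \<omega> - T (Suc i) \<omega>"
  have int: "integrable M (\<lambda>\<omega>. ?E i \<omega> * ?E j \<omega>)" if "i < l" "j < l" for i j
    using that by (intro sq_integrable_imp_integrable_mult E) auto
  have "(\<integral>\<omega>. (\<Sum>i<l. vec_index k i * ?E i \<omega>)\<^sup>2 \<partial>M)
      = (\<integral>\<omega>. (\<Sum>i<l. \<Sum>j<l. vec_index k i * vec_index k j * (?E i \<omega> * ?E j \<omega>)) \<partial>M)"
    by (simp add: power2_eq_square sum_product mult_ac)
  also have "\<dots> = (\<Sum>i<l. \<Sum>j<l. vec_index k i * vec_index k j * (\<integral>\<omega>. ?E i \<omega> * ?E j \<omega> \<partial>M))"
    using int by (subst Bochner_Integration.integral_sum,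
        auto intro!: Bochner_Integration.integrable_sum sum.cong)+
  also have "\<dots> = scalar_prod k (mspe_mat M l P T *\<^sub>v k)"
    unfolding mspe_mat_def quadratic_form_eq_sum[OF k] by simp
  finally show ?thesis ..
qed

text \<open>The projection theorem in \<open>L\<^sup>2\<close>, for arbitrary square-integrable
  \<open>Y\<close> and \<open>T\<close>: errors orthogonal to the span of the observations are
  optimal for all weights \<open>k\<close> at once.\<close>

lemma orthogonal_imp_mspe_le:
  assumes k: "k \<in> carrier_vec l"
    and Y: "\<And>j. j \<in> {1..r} \<Longrightarrow> sq_integrable M (Y j)"
    and T: "\<And>i. i \<in> {1..l} \<Longrightarrow> sq_integrable M (T i)"
    and orth: "\<And>i j. i \<in> {1..l} \<Longrightarrow> j \<in> {1..r} \<Longrightarrow>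
      (\<integral>\<omega>. (linear_predictor r Y (b i) \<omega> - T i \<omega>) * Y j \<omega> \<partial>M) = 0"
  shows "scalar_prod k (mspe_mat M l (\<lambda>i. linear_predictor r Y (b i)) T *\<^sub>v k)
    \<le> scalar_prod k (mspe_mat M l (\<lambda>i. linear_predictor r Y (a i)) T *\<^sub>v k)"
proof -
  have LP: "sq_integrable M (linear_predictor r Y c)" for c
    unfolding linear_predictor_eq_sum[abs_def]
    using Y by (intro sq_integrable_sum sq_integrable_cmult) auto
  have err: "sq_integrable M (\<lambda>\<omega>. linear_predictor r Y (c i) \<omega> - T i \<omega>)"
    if "i \<in> {1..l}" for c i
    using that by (intro sq_integrable_diff LP T)
  \<comment> \<open>The combined difference of the two families of predictors, with coefficients
    collected for each \<open>Y (Suc j)\<close>, so that it visibly lies in the span of the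
    observations. \<open>R\<close> is the combined error of the predictors \<open>b\<close>.\<close>
  define D where "D = (\<lambda>\<omega>. \<Sum>j<r. (\<Sum>i<l. vec_index k i *
    (vec_index (a (Suc i)) j - vec_index (b (Suc i)) j)) * Y (Suc j) \<omega>)"
  define R where
    "R = (\<lambda>\<omega>. \<Sum>i<l. vec_index k i * (linear_predictor r Y (b (Suc i)) \<omega> - T (Suc i) \<omega>))"
  have D: "sq_integrable M D"
    unfolding D_def using Y by (intro sq_integrable_sum sq_integrable_cmult) auto
  have R: "sq_integrable M R"
    unfolding R_def using err by (intro sq_integrable_sum sq_integrable_cmult) auto
  have RY: "(\<integral>\<omega>. R \<omega> * Y (Suc j) \<omega> \<partial>M) = 0" if j: "j < r" for j
  proof -
    have "integrable M (\<lambda>\<omega>. (linear_predictor r Y (b (Suc i)) \<omega> - T (Suc i) \<omega>) * Y (Suc j) \<omega>)"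
      if "i < l" for i
      using that j err Y by (intro sq_integrable_imp_integrable_mult) auto
    then have "(\<integral>\<omega>. R \<omega> * Y (Suc j) \<omega> \<partial>M) = (\<Sum>i<l. vec_index k i *
        (\<integral>\<omega>. (linear_predictor r Y (b (Suc i)) \<omega> - T (Suc i) \<omega>) * Y (Suc j) \<omega> \<partial>M))"
      by (simp add: R_def sum_distrib_right mult.assoc Bochner_Integration.integral_sum)
    then show ?thesis
      using j by (simp add: orth)
  qed
  have RD: "(\<integral>\<omega>. R \<omega> * D \<omega> \<partial>M) = 0"
  proof -
    have "integrable M (\<lambda>\<omega>. R \<omega> * Y (Suc j) \<omega>)" if "j < r" for j
      using that R Y by (intro sq_integrable_imp_integrable_mult) auto
    then have "(\<integral>\<omega>. R \<omega> * D \<omega> \<partial>M) = (\<Sum>j<r. (\<Sum>i<l. vec_index k i *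
        (vec_index (a (Suc i)) j - vec_index (b (Suc i)) j)) * (\<integral>\<omega>. R \<omega> * Y (Suc j) \<omega> \<partial>M))"
      by (simp add: D_def sum_distrib_left mult.left_commute[of "R _"] Bochner_Integration.integral_sum)
    then show ?thesis
      by (simp add: RY)
  qed
  \<comment> \<open>Interchanging the two sums in \<open>D\<close> recovers the weighted differences
    of predictors, so the competitor's combined error is \<open>R + D\<close>.\<close>
  have split: "(\<Sum>i<l. vec_index k i * (linear_predictor r Y (a (Suc i)) \<omega> - T (Suc i) \<omega>))
      = R \<omega> + D \<omega>" for \<omega>
  proof -
    have "D \<omega> = (\<Sum>i<l. \<Sum>j<r. vec_index k i *
        (vec_index (a (Suc i)) j - vec_index (b (Suc i)) j) * Y (Suc j) \<omega>)"
      unfolding D_def sum_distrib_right by (rule sum.swap)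
    also have "\<dots> = (\<Sum>i<l. vec_index k i *
        (linear_predictor r Y (a (Suc i)) \<omega> - linear_predictor r Y (b (Suc i)) \<omega>))"
      by (simp add: linear_predictor_eq_sum sum_distrib_left mult.assoc
          left_diff_distrib flip: sum_subtractf)
    finally show ?thesis
      by (simp add: R_def algebra_simps flip: sum.distrib)
  qed
  have "(\<integral>\<omega>. (R \<omega> + D \<omega>)\<^sup>2 \<partial>M)
      = (\<integral>\<omega>. (R \<omega>)\<^sup>2 \<partial>M) + (\<integral>\<omega>. (D \<omega>)\<^sup>2 \<partial>M) + 2 * (\<integral>\<omega>. R \<omega> * D \<omega> \<partial>M)"
    using R D sq_integrable_imp_integrable_mult[OF R D]
    by (simp add: power2_sum mult.assoc sq_integrable_def)
  \<comment> \<open>The cross term vanishes by \<open>RD\<close>, and the integral of the square of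
    \<open>D\<close> is nonnegative.\<close>
  then have "(\<integral>\<omega>. (R \<omega>)\<^sup>2 \<partial>M) \<le> (\<integral>\<omega>. (R \<omega> + D \<omega>)\<^sup>2 \<partial>M)"
    by (simp add: RD)
  moreover have "scalar_prod k (mspe_mat M l (\<lambda>i. linear_predictor r Y (b i)) T *\<^sub>v k)
      = (\<integral>\<omega>. (R \<omega>)\<^sup>2 \<partial>M)"
    using mspe_quadratic_form[OF k err[of _ b]] by (simp add: R_def)
  moreover have "scalar_prod k (mspe_mat M l (\<lambda>i. linear_predictor r Y (a i)) T *\<^sub>v k)
      = (\<integral>\<omega>. (R \<omega> + D \<omega>)\<^sup>2 \<partial>M)"
    using mspe_quadratic_form[OF k err[of _ a]] by (simp add: split)
  ultimately show ?thesis by simp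
qed

subsection \<open>The normal equations\<close>

text \<open>The rank-one term contributes the square of the scalar product of \<open>u\<close> and
  \<open>v\<close>, which is nonnegative.\<close>

lemma pos_def_add_outer_prod:
  assumes A: "pos_def_mat r A" and u: "u \<in> carrier_vec r"
    and v: "v \<in> carrier_vec r" "v \<noteq> 0\<^sub>v r"
  shows "0 < scalar_prod v ((A + outer_prod u u) *\<^sub>v v)"
proof -
  have A': "A \<in> carrier_mat r r" and pos: "0 < scalar_prod v (A *\<^sub>v v)"
    using A v by (auto simp: pos_def_mat_def)
  have U: "outer_prod u u \<in> carrier_mat r r"
    using u by (simp add: outer_prod_def)
  have "outer_prod u u *\<^sub>v v = scalar_prod u v \<cdot>\<^sub>v u"
    using u v by (intro eq_vecI)
      (auto simp: outer_prod_def scalar_prod_def sum_distrib_left sum_distrib_right mult_ac)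
  then have "scalar_prod v ((A + outer_prod u u) *\<^sub>v v)
      = scalar_prod v (A *\<^sub>v v) + scalar_prod u v * scalar_prod v u"
    using A' U u v
    by (simp add: add_mult_distrib_mat_vec[of _ r r] scalar_prod_add_distrib[of _ r])
  also have "scalar_prod v u = scalar_prod u v"
    using v(1) u by (rule comm_scalar_prod)
  finally show ?thesis
    using pos by (simp add: add_pos_nonneg)
qed

text \<open>A trivial kernel forces a nonzero determinant, so \<open>mat_inverse\<close> returns
  \<open>Some\<close> and \<open>the\<close> extracts a genuine inverse.\<close>

lemma mat_inverse_mult_vec:
  fixes A :: "'a::field mat"
  assumes A: "A \<in> carrier_mat r r" and d: "d \<in> carrier_vec r"
    and inj: "\<And>v. v \<in> carrier_vec r \<Longrightarrow> v \<noteq> 0\<^sub>v r \<Longrightarrow> A *\<^sub>v v \<noteq> 0\<^sub>v r"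
  shows "the (mat_inverse A) *\<^sub>v d \<in> carrier_vec r"
    and "A *\<^sub>v (the (mat_inverse A) *\<^sub>v d) = d"
proof -
  have "det A \<noteq> 0"
    using inj A det_0_iff_vec_prod_zero[OF A] by auto
  \<comment> \<open>The last argument of \<open>ring_mat\<close> only fills the extension field of
    the ring record, so \<open>undefined\<close> serves as well as any value.\<close>
  then have "A \<in> Units (ring_mat TYPE('a) r undefined)"
    by (rule det_non_zero_imp_unit[OF A])
  then obtain B where B: "mat_inverse A = Some B"
    using mat_inverse(1)[OF A] by fastforce
  from mat_inverse(2)[OF A B] have *: "A * B = 1\<^sub>m r" "B \<in> carrier_mat r r"
    by auto
  then show "the (mat_inverse A) *\<^sub>v d \<in> carrier_vec r"
    using d B by simp
  show "A *\<^sub>v (the (mat_inverse A) *\<^sub>v d) = d"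
    using * A B d by (simp flip: assoc_mult_mat_vec)
qed

lemma blip_coeff_normal_equations:
  assumes "pos_def_mat r (cov_mat M Z r)"
  shows "Gamma_mat M Z r \<delta> *\<^sub>v blip_coeff M Z r \<delta> s = Delta_vec M Z r \<delta> s"
    and "blip_coeff M Z r \<delta> s \<in> carrier_vec r"
proof -
  have \<beta>: "shifted_mean M Z r \<delta> \<in> carrier_vec r"
    by (simp add: shifted_mean_def mean_vec_def ones_vec_def)
  \<comment> \<open>A nonzero \<open>v\<close> in the kernel of \<Gamma> would give the quadratic
    form the value 0, against its positivity.\<close>
  have inj: "Gamma_mat M Z r \<delta> *\<^sub>v v \<noteq> 0\<^sub>v r" if "v \<in> carrier_vec r" "v \<noteq> 0\<^sub>v r" for v
    using pos_def_add_outer_prod[OF assms \<beta> that] that by (auto simp: Gamma_mat_def)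
  have \<Gamma>: "Gamma_mat M Z r \<delta> \<in> carrier_mat r r"
    using \<beta> by (simp add: Gamma_mat_def cov_mat_def outer_prod_def)
  have \<Delta>: "Delta_vec M Z r \<delta> s \<in> carrier_vec r"
    using \<beta> by (simp add: Delta_vec_def cross_cov_vec_def)
  show "Gamma_mat M Z r \<delta> *\<^sub>v blip_coeff M Z r \<delta> s = Delta_vec M Z r \<delta> s"
    "blip_coeff M Z r \<delta> s \<in> carrier_vec r"
    using mat_inverse_mult_vec[OF \<Gamma> \<Delta> inj] by (auto simp: blip_coeff_def)
qed

text \<open>Up to the factor \<open>\<sigma>\<^sup>2\<close>, the inner product of the error with
  \<open>Y j\<close> is an entry of \<Gamma> b - \<Delta>, which is zero by the normal
  equations.\<close>

lemma (in prob_space) blip_orthogonal: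
  fixes \<sigma> \<mu> :: real
  assumes "pos_def_mat r (cov_mat M Z r)"
    and Z: "\<And>i. i \<in> {1..r} \<Longrightarrow> sq_integrable M (Z i)" "sq_integrable M (Z s)"
    and Y: "\<And>i. Y i = (\<lambda>\<omega>. \<sigma> * (Z i \<omega> + \<delta>))"
    and j: "j \<in> {1..r}"
  shows "(\<integral>\<omega>. (linear_predictor r Y (blip_coeff M Z r \<delta> s) \<omega> - Y s \<omega>) * Y j \<omega> \<partial>M) = 0"
proof -
  let ?b = "blip_coeff M Z r \<delta> s"
  \<comment> \<open>\<open>m\<close> is the zero-based vector index belonging to the observation
    \<open>Y j\<close>.\<close>
  obtain m where m: "j = Suc m" "m < r"
    using j by (cases j) auto
  have moment: "(\<integral>\<omega>. Y p \<omega> * Y q \<omega> \<partial>M) = \<sigma>\<^sup>2 * (covariance M (Z p) (Z q)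
      + ((\<integral>\<omega>. Z p \<omega> \<partial>M) + \<delta>) * ((\<integral>\<omega>. Z q \<omega> \<partial>M) + \<delta>))"
    if "sq_integrable M (Z p)" "sq_integrable M (Z q)" for p q
  proof -
    have "Y p \<omega> * Y q \<omega> = \<sigma>\<^sup>2 * ((Z p \<omega> + \<delta>) * (Z q \<omega> + \<delta>))" for \<omega>
      by (simp add: Y power2_eq_square mult_ac)
    then show ?thesis
      using integral_mult_shift[OF that, of \<delta> \<delta>] by simp
  qed
  have sqY: "sq_integrable M (Y p)" if "sq_integrable M (Z p)" for p
    unfolding Y using that by (intro sq_integrable_cmult sq_integrable_add sq_integrable_const)
  \<comment> \<open>\<open>moment\<close> yields covariances with \<open>Z j\<close> as second
    argument, whereas row \<open>m\<close> of \<Gamma> and entry \<open>m\<close> of \<Delta> have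
    it first.\<close>
  have cov_sym: "covariance M U V = covariance M V U" for U V
    by (simp add: covariance_def mult.commute)
  have \<Gamma>: "(\<integral>\<omega>. Y (Suc i) \<omega> * Y j \<omega> \<partial>M) = \<sigma>\<^sup>2 * Gamma_mat M Z r \<delta> $$ (m, i)" if "i < r" for i
    using that m Z cov_sym by (subst moment)
      (auto simp: Gamma_mat_def cov_mat_def outer_prod_def shifted_mean_def mean_vec_def
        ones_vec_def mult.commute)
  have \<Delta>: "(\<integral>\<omega>. Y s \<omega> * Y j \<omega> \<partial>M) = \<sigma>\<^sup>2 * vec_index (Delta_vec M Z r \<delta> s) m"
    using m Z cov_sym by (subst moment)
      (auto simp: Delta_vec_def cross_cov_vec_def shifted_mean_def mean_vec_def ones_vec_def)
  have int: "integrable M (\<lambda>\<omega>. Y (Suc i) \<omega> * Y j \<omega>)" if "i < r" for i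
    using that j Z by (intro sq_integrable_imp_integrable_mult sqY) auto
  have ints: "integrable M (\<lambda>\<omega>. Y s \<omega> * Y j \<omega>)"
    using j Z by (intro sq_integrable_imp_integrable_mult sqY) auto
  have "(\<integral>\<omega>. (linear_predictor r Y ?b \<omega> - Y s \<omega>) * Y j \<omega> \<partial>M)
      = (\<integral>\<omega>. (\<Sum>i<r. vec_index ?b i * (Y (Suc i) \<omega> * Y j \<omega>)) - Y s \<omega> * Y j \<omega> \<partial>M)"
    by (simp add: linear_predictor_eq_sum left_diff_distrib sum_distrib_right mult.assoc)
  also have "\<dots> = (\<Sum>i<r. vec_index ?b i * (\<integral>\<omega>. Y (Suc i) \<omega> * Y j \<omega> \<partial>M))
      - (\<integral>\<omega>. Y s \<omega> * Y j \<omega> \<partial>M)"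
    using int ints by (subst Bochner_Integration.integral_diff,
        auto intro!: Bochner_Integration.integrable_sum simp: Bochner_Integration.integral_sum)
  also have "\<dots> = \<sigma>\<^sup>2 * ((\<Sum>i<r. Gamma_mat M Z r \<delta> $$ (m, i) * vec_index ?b i)
      - vec_index (Delta_vec M Z r \<delta> s) m)"
    by (simp add: \<Gamma> \<Delta> sum_distrib_left right_diff_distrib mult.left_commute
        mult.commute[of "vec_index ?b _"])
  \<comment> \<open>The matrix-vector product sums up to the dimension of the coefficient vector;
    the second part of \<open>blip_coeff_normal_equations\<close> makes this
    \<open>r\<close>.\<close>
  also have "(\<Sum>i<r. Gamma_mat M Z r \<delta> $$ (m, i) * vec_index ?b i)
      = vec_index (Gamma_mat M Z r \<delta> *\<^sub>v ?b) m"
    using m blip_coeff_normal_equations(2)[OF assms(1), of \<delta> s]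
    by (simp add: scalar_prod_def lessThan_atLeast0 Gamma_mat_def outer_prod_def
        shifted_mean_def mean_vec_def ones_vec_def)
  also have "\<dots> = vec_index (Delta_vec M Z r \<delta> s) m"
    by (simp add: blip_coeff_normal_equations(1)[OF assms(1)])
  finally show ?thesis by simp
qed

section \<open>Dominance for order statistics of a location-scale sample\<close>

theorem corollary2:
  fixes M :: "'w measure" and f :: "real \<Rightarrow> real" and X :: "nat \<Rightarrow> 'w \<Rightarrow> real"
    and \<mu> \<sigma> :: real and n r l :: nat and s :: "nat \<Rightarrow> nat"
  assumes "prob_space M"
    and "is_pdf f"
    and "0 < \<sigma>"
    and "iid_sample M n X (\<lambda>x. 1 / \<sigma> * f ((x - \<mu>) / \<sigma>))"
    and "\<And>i. i \<in> {1..n} \<Longrightarrow> integrable M (\<lambda>\<omega>. (std_order_stat \<mu> \<sigma> n X i \<omega>)\<^sup>2)"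
    and "1 \<le> r" and "r < n"
    and "pos_def_mat r (cov_mat M (std_order_stat \<mu> \<sigma> n X) r)"
    and "1 \<le> l" and "strict_mono_on {1..l} s" and "r < s 1" and "s l \<le> n"
  shows "\<forall>a :: nat \<Rightarrow> real vec. (\<forall>i\<in>{1..l}. a i \<in> carrier_vec r) \<longrightarrow>
    (\<forall>k\<in>carrier_vec l.
      scalar_prod k
        (mspe_mat M l
          (\<lambda>i. linear_predictor r (order_stat n X)
                 (blip_coeff M (std_order_stat \<mu> \<sigma> n X) r (\<mu> / \<sigma>) (s i)))
          (\<lambda>i. order_stat n X (s i)) *\<^sub>v k)
      \<le> scalar_prod k
        (mspe_mat M l
          (\<lambda>i. linear_predictor r (order_stat n X) (a i))
          (\<lambda>i. order_stat n X (s i)) *\<^sub>v k))"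
proof (intro allI impI ballI)
  fix a :: "nat \<Rightarrow> real vec" and k :: "real vec"
  assume k: "k \<in> carrier_vec l"
  interpret prob_space M by fact
  let ?Z = "std_order_stat \<mu> \<sigma> n X" and ?Y = "order_stat n X"
  \<comment> \<open>Inverts the standardization, which is possible since \<sigma> is nonzero; the
    shift is \<delta> = \<mu> / \<sigma>.\<close>
  have Y: "?Y i = (\<lambda>\<omega>. \<sigma> * (?Z i \<omega> + \<mu> / \<sigma>))" for i
    using \<open>0 < \<sigma>\<close> by (simp add: std_order_stat_def fun_eq_iff field_simps)
  have X: "X j \<in> borel_measurable M" if "j \<in> {1..n}" for j
  proof -
    have "distributed M lborel (X j) (\<lambda>x. ennreal (1 / \<sigma> * f ((x - \<mu>) / \<sigma>)))"
      using assms(4) that unfolding iid_sample_def by blast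
    then show ?thesis
      using distributed_measurable by fastforce
  qed
  have Z: "sq_integrable M (?Z i)" if "i \<in> {1..n}" for i
  proof -
    have "?Z i \<in> borel_measurable M"
      unfolding std_order_stat_def[abs_def] using order_stat_measurable[OF X that] by simp
    then show ?thesis
      using assms(5)[OF that] by (simp add: sq_integrable_def)
  qed
  have sqY: "sq_integrable M (?Y i)" if "i \<in> {1..n}" for i
    unfolding Y
    by (intro sq_integrable_cmult sq_integrable_add sq_integrable_const Z that)
  \<comment> \<open>Monotonicity places \<open>s i\<close> between \<open>s 1\<close>, which exceeds
    \<open>r\<close>, and \<open>s l\<close>, which is at most \<open>n\<close>; hence the predicted
    order statistics also have second moments.\<close>
  have s: "s i \<in> {1..n}" if "i \<in> {1..l}" for i
  proof -
    have "s 1 \<le> s i" "s i \<le> s l"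
      using that strict_mono_on_leD[OF assms(10)] by auto
    then show ?thesis
      using \<open>r < s 1\<close> \<open>s l \<le> n\<close> by simp
  qed
  show "scalar_prod k
      (mspe_mat M l (\<lambda>i. linear_predictor r ?Y (blip_coeff M ?Z r (\<mu> / \<sigma>) (s i)))
        (\<lambda>i. ?Y (s i)) *\<^sub>v k)
    \<le> scalar_prod k (mspe_mat M l (\<lambda>i. linear_predictor r ?Y (a i)) (\<lambda>i. ?Y (s i)) *\<^sub>v k)"
  proof (rule orthogonal_imp_mspe_le[OF k])
    show "sq_integrable M (?Y j)" if "j \<in> {1..r}" for j
      using that \<open>r < n\<close> by (intro sqY) auto
    show "sq_integrable M (?Y (s i))" if "i \<in> {1..l}" for i
      using that by (intro sqY s)
    show "(\<integral>\<omega>. (linear_predictor r ?Y (blip_coeff M ?Z r (\<mu> / \<sigma>) (s i)) \<omega> - ?Y (s i) \<omega>)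
        * ?Y j \<omega> \<partial>M) = 0" if "i \<in> {1..l}" "j \<in> {1..r}" for i j
      using that \<open>r < n\<close> by (intro blip_orthogonal[OF assms(8) _ _ Y] Z s) auto
  qed
qed

end
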